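(* Let $n\in\mathbb P$, let $\mathbf a\in\mathbb{N}^n$, and let $\Delta$ be a simplicial complex. If $\Delta$ is $\mathbf a$-Macaulay decomposable, then $\Delta$ is vertex-decomposable, and a Macaulay shedding vertex of $\Delta$ is a shedding vertex of $\Delta$.
   Context: $\mathbb N=\{0,1,\dots\}$, $\mathbb P=\{1,2,\dots\}$; for $\mathbf x,\mathbf y\in\mathbb Z^n$, $\mathbf x\le\mathbf y$ is componentwise, $\mathbf x<\mathbf y$ means $\mathbf x\le\mathbf y$ and $\mathbf x\neq\mathbf y$, and $|\mathbf x|=x_1+\dots+x_n$. A simplicial complex $\Delta$ on a finite vertex set $V$ is a collection of subsets of $V$ closed under taking subsets with $\{v\}\in\Delta$ for all $v\in V$; facets are maximal faces. $\langle\mathcal F\rangle$ denotes the smallest simplicial complex containing all sets of a family $\mathcal F$. A simplex is a complex generated by one face. For a vertex $x$, $\mathrm{dl}_\Delta(x)=\{\tau\in\Delta:x\notin\tau\}$ and $\mathrm{lk}_\Delta(x)=\{\tau\in\Delta:x\notin\tau,\ \tau\cup\{x\}\in\Delta\}$. The complex $\{\emptyset\}$ is allowed as a link or deletion. $\Delta$ on $V$ is vertex-decomposable (not necessarily pure) if (i) $\Delta$ is a simplex or $\Delta=\{\emptyset\}$; or (ii) there is $x\in V$, called a shedding vertex of $\Delta$, such that $\mathrm{dl}_\Delta(x)$ and $\mathrm{lk}_\Delta(x)$ are vertex-decomposable and no facet of $\mathrm{lk}_\Delta(x)$ is a facet of $\mathrm{dl}_\Delta(x)$. For $\mathbf a\in\mathbb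 N^n$, an $\mathbf a$-rib of a complex $\Delta$ on $V$ is a subcomplex of the form $\langle\{F_1\cup\dots\cup F_n\in\Delta: F_i\subseteq V_i,\ |F_i|=a_i\text{ for each }i\}\rangle$ for some ordered partition $(V_1,\dots,V_n)$ of $V$ into non-empty sets (with the generating family non-empty, so a rib is pure of dimension $|\mathbf a|-1$). $\Delta$ on $V$ is $\mathbf a$-Macaulay decomposable if (i) $\Delta$ is an $\mathbf a$-rib of a simplex; or (ii) there exist $x\in V$, called a Macaulay shedding vertex of $\Delta$, and $\mathbf a'\in\mathbb N^n$ with $\mathbf a'<\mathbf a$ such that $\mathrm{dl}_\Delta(x)$ is $\mathbf a$-Macaulay decomposable, $\mathrm{lk}_\Delta(x)$ is $\mathbf a'$-Macaulay decomposable, and no facet of $\mathrm{lk}_\Delta(x)$ is a facet of $\mathrm{dl}_\Delta(x)$. *)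

theory Defs
  imports "HOL-Analysis.Analysis"
begin

definition abstract_simplicial_complex :: "'a set \<Rightarrow> 'a set set \<Rightarrow> bool" where
  "abstract_simplicial_complex V \<Delta> \<longleftrightarrow>
     finite V \<and> \<Delta> \<subseteq> Pow V \<and>
     (\<forall>\<sigma>\<in>\<Delta>. \<forall>\<tau>. \<tau> \<subseteq> \<sigma> \<longrightarrow> \<tau> \<in> \<Delta>) \<and> (\<forall>v\<in>V. {v} \<in> \<Delta>)"

text \<open>Every vertex is a face, so the vertex set is determined by the complex; the notions
  below therefore take only the family of faces as argument.\<close>

lemma abstract_simplicial_complex_vertices: "abstract_simplicial_complex V \<Delta> \<Longrightarrow> V = \<Union>\<Delta>"
  by (auto simp: abstract_simplicial_complex_def)

definition facet :: "'a set set \<Rightarrow> 'a set \<Rightarrow> bool" where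
  "facet \<Delta> \<sigma> \<longleftrightarrow> \<sigma> \<in> \<Delta> \<and> (\<forall>\<tau>\<in>\<Delta>. \<sigma> \<subseteq> \<tau> \<longrightarrow> \<tau> = \<sigma>)"

definition generated_complex :: "'a set set \<Rightarrow> 'a set set" where
  "generated_complex \<F> = {\<sigma>. \<exists>\<tau>\<in>\<F>. \<sigma> \<subseteq> \<tau>}"

lemma generated_complex_is_complex:
  assumes "finite (\<Union>\<F>)"
  shows "abstract_simplicial_complex (\<Union>\<F>) (generated_complex \<F>)"
  using assms by (auto simp: abstract_simplicial_complex_def generated_complex_def)

lemma generated_complex_contains: "\<F> \<subseteq> generated_complex \<F>"
  by (auto simp: generated_complex_def)

lemma generated_complex_least:
  assumes "abstract_simplicial_complex V \<Delta>" "\<F> \<subseteq> \<Delta>"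
  shows "generated_complex \<F> \<subseteq> \<Delta>"
  using assms by (auto simp: abstract_simplicial_complex_def generated_complex_def)

definition is_simplex :: "'a set set \<Rightarrow> bool" where
  "is_simplex \<Delta> \<longleftrightarrow> (\<exists>\<sigma>. finite \<sigma> \<and> \<Delta> = generated_complex {\<sigma>})"

definition deletion :: "'a set set \<Rightarrow> 'a \<Rightarrow> 'a set set" where
  "deletion \<Delta> x = {\<tau>\<in>\<Delta>. x \<notin> \<tau>}"

definition link :: "'a set set \<Rightarrow> 'a \<Rightarrow> 'a set set" where
  "link \<Delta> x = {\<tau>\<in>\<Delta>. x \<notin> \<tau> \<and> \<tau> \<union> {x} \<in> \<Delta>}"

inductive vertex_decomposable :: "'a set set \<Rightarrow> bool"
  and shedding_vertex :: "'a set set \<Rightarrow> 'a \<Rightarrow> bool" where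
  vd_simplex: "is_simplex \<Delta> \<or> \<Delta> = {{}} \<Longrightarrow> vertex_decomposable \<Delta>"
| vd_shed: "shedding_vertex \<Delta> x \<Longrightarrow> vertex_decomposable \<Delta>"
| shedding_vertexI:
    "\<lbrakk>abstract_simplicial_complex V \<Delta>; x \<in> V;
      vertex_decomposable (deletion \<Delta> x); vertex_decomposable (link \<Delta> x);
      \<nexists>\<sigma>. facet (link \<Delta> x) \<sigma> \<and> facet (deletion \<Delta> x) \<sigma>\<rbrakk>
     \<Longrightarrow> shedding_vertex \<Delta> x"

text \<open>Vectors in \<open>\<nat>\<^sup>n\<close> are elements of \<^typ>\<open>nat ^ 'n\<close>, whose library order is
  componentwise; \<open>a' < a\<close> means \<open>a' \<le> a\<close> and \<open>a' \<noteq> a\<close>. An ordered partition into \<open>n\<close> parts is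
  a family indexed by \<^typ>\<open>'n\<close>.\<close>

definition ordered_partition :: "'a set \<Rightarrow> ('n::finite \<Rightarrow> 'a set) \<Rightarrow> bool" where
  "ordered_partition V P \<longleftrightarrow> (\<Union>i. P i) = V \<and> (\<forall>i. P i \<noteq> {}) \<and> disjoint_family P"

definition rib_generators ::
    "nat ^ 'n::finite \<Rightarrow> 'a set set \<Rightarrow> ('n \<Rightarrow> 'a set) \<Rightarrow> 'a set set" where
  "rib_generators a \<Delta> P =
     {(\<Union>i. F i) | F. (\<Union>i. F i) \<in> \<Delta> \<and> (\<forall>i. F i \<subseteq> P i \<and> card (F i) = a $ i)}"

definition is_rib :: "nat ^ 'n::finite \<Rightarrow> 'a set \<Rightarrow> 'a set set \<Rightarrow> 'a set set \<Rightarrow> bool" where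
  "is_rib a V \<Delta> \<Gamma> \<longleftrightarrow>
     (\<exists>P. ordered_partition V P \<and> rib_generators a \<Delta> P \<noteq> {} \<and>
          \<Gamma> = generated_complex (rib_generators a \<Delta> P))"

text \<open>In the first rule the simplex may have more vertices than its rib: a part \<open>P i\<close> with
  \<open>a $ i = 0\<close> contributes no vertex to the rib.\<close>

inductive macaulay_decomposable :: "nat ^ 'n::finite \<Rightarrow> 'a set set \<Rightarrow> bool"
  and macaulay_shedding_vertex :: "nat ^ 'n::finite \<Rightarrow> 'a set set \<Rightarrow> 'a \<Rightarrow> bool" where
  md_rib:
    "\<lbrakk>abstract_simplicial_complex V \<Sigma>; is_simplex \<Sigma>; is_rib a V \<Sigma> \<Delta>\<rbrakk> \<Longrightarrow> macaulay_decomposable a \<Delta>"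
| md_shed: "macaulay_shedding_vertex a \<Delta> x \<Longrightarrow> macaulay_decomposable a \<Delta>"
| macaulay_shedding_vertexI:
    "\<lbrakk>abstract_simplicial_complex V \<Delta>; x \<in> V; a' < a;
      macaulay_decomposable a (deletion \<Delta> x); macaulay_decomposable a' (link \<Delta> x);
      \<nexists>\<sigma>. facet (link \<Delta> x) \<sigma> \<and> facet (deletion \<Delta> x) \<sigma>\<rbrakk>
     \<Longrightarrow> macaulay_shedding_vertex a \<Delta> x"

end

theory Submission
  imports Defs
begin

text \<open>The recursive clauses of the two notions differ only in the vectors \<open>a' < a\<close> that Macaulay
  decomposability records, so an induction over the derivation reduces the theorem to its base case:
  a rib of a simplex is vertex-decomposable. Colour the vertices by the part of the ordered partition
  that contains them. The rib consists of the sets with at most \<open>a $ i\<close> vertices of each colour \<open>i\<close>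
  (lemma \<open>rib_of_simplex\<close>); in other words, it is the independence complex of a partition matroid.
  Such complexes are closed under deletion and under links at a vertex \<open>x\<close>, where the link lowers the
  bound for the colour of \<open>x\<close> by one. If that colour occurs more often than its bound allows, then
  every face of the link can be enlarged inside the deletion by another vertex of the same colour,
  which makes \<open>x\<close> a shedding vertex. If no vertex \<open>x\<close> of this kind is left, the complex is a
  simplex. Induction on the number of vertices proves lemma
  \<open>vertex_decomposable_bounded_colour_complex\<close>.\<close>

definition bounded_colour_complex :: "('a \<Rightarrow> 'c) \<Rightarrow> ('c \<Rightarrow> nat) \<Rightarrow> 'a set \<Rightarrow> 'a set set" where
  "bounded_colour_complex c b W = {F. F \<subseteq> W \<and> (\<forall>i. card {v\<in>F. c v = i} \<le> b i)}"

text \<open>A colour with bound \<open>0\<close> contributes no vertex, so the vertex set can be smaller than \<open>W\<close>.\<close>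

lemma bounded_colour_complex_is_complex:
  assumes "finite W"
  shows "abstract_simplicial_complex {v\<in>W. 0 < b (c v)} (bounded_colour_complex c b W)"
proof -
  have pos: "0 < b (c v)" if F: "F \<subseteq> W" "\<forall>i. card {u\<in>F. c u = i} \<le> b i" and "v \<in> F" for F v
  proof -
    have "finite {u\<in>F. c u = c v}" using F(1) assms finite_subset by fastforce
    then have "0 < card {u\<in>F. c u = c v}" using \<open>v \<in> F\<close> by (auto simp: card_gt_0_iff)
    then show ?thesis using F(2) by (meson le_trans not_le)
  qed
  have down: "card {u\<in>G. c u = i} \<le> b i"
    if "F \<subseteq> W" "\<forall>i. card {u\<in>F. c u = i} \<le> b i" "G \<subseteq> F" for F G i
  proof -
    have "finite {u\<in>F. c u = i}" using that(1) assms finite_subset by fastforce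
    then have "card {u\<in>G. c u = i} \<le> card {u\<in>F. c u = i}"
      using that(3) by (intro card_mono) auto
    then show ?thesis using that(2) le_trans by blast
  qed
  have single: "card {u\<in>{v}. c u = i} \<le> b i" if "0 < b (c v)" for v i
  proof (cases "c v = i")
    case True
    then have "{u\<in>{v}. c u = i} = {v}" by auto
    then show ?thesis using that True by simp
  next
    case False
    then have "{u\<in>{v}. c u = i} = {}" by auto
    then show ?thesis by (metis card.empty le0)
  qed
  show ?thesis
    unfolding abstract_simplicial_complex_def
  proof (intro conjI ballI allI impI)
    show "finite {v \<in> W. 0 < b (c v)}" using assms by simp
    show "bounded_colour_complex c b W \<subseteq> Pow {v \<in> W. 0 < b (c v)}"
      using pos unfolding bounded_colour_complex_def by blast
    show "G \<in> bounded_colour_complex c b W"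
      if "F \<in> bounded_colour_complex c b W" "G \<subseteq> F" for F G
      using that down unfolding bounded_colour_complex_def by blast
    show "{v} \<in> bounded_colour_complex c b W" if "v \<in> {v \<in> W. 0 < b (c v)}" for v
      using that single unfolding bounded_colour_complex_def by blast
  qed
qed

lemma deletion_bounded_colour_complex:
  "deletion (bounded_colour_complex c b W) x = bounded_colour_complex c b (W - {x})"
  unfolding deletion_def bounded_colour_complex_def by blast

lemma link_bounded_colour_complex:
  assumes "finite W" "x \<in> W" "0 < b (c x)"
  shows "link (bounded_colour_complex c b W) x =
         bounded_colour_complex c (b(c x := b (c x) - 1)) (W - {x})"
proof -
  have key: "(\<forall>i. card {v\<in>insert x F. c v = i} \<le> b i) \<longleftrightarrow>
        (\<forall>i. card {v\<in>F. c v = i} \<le> (b(c x := b (c x) - 1)) i)"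
    if "F \<subseteq> W" "x \<notin> F" for F
  proof -
    have "card {v\<in>insert x F. c v = i} \<le> b i \<longleftrightarrow>
        card {v\<in>F. c v = i} \<le> (b(c x := b (c x) - 1)) i" for i
    proof (cases "i = c x")
      case True
      have "finite {v\<in>F. c v = i}" using that(1) assms(1) finite_subset by fastforce
      moreover have "{v\<in>insert x F. c v = i} = insert x {v\<in>F. c v = i}" using True by auto
      ultimately have "card {v\<in>insert x F. c v = i} = Suc (card {v\<in>F. c v = i})"
        using that(2) by simp
      then show ?thesis using True assms(3) by auto
    next
      case False
      then have "{v\<in>insert x F. c v = i} = {v\<in>F. c v = i}" by auto
      then show ?thesis using False by simp
    qed
    then show ?thesis by simp
  qed
  have "abstract_simplicial_complex {v\<in>W. 0 < b (c v)} (bounded_colour_complex c b W)"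
    using bounded_colour_complex_is_complex assms(1) .
  then have "F \<in> bounded_colour_complex c b W" if "insert x F \<in> bounded_colour_complex c b W" for F
    using that unfolding abstract_simplicial_complex_def by blast
  then have "link (bounded_colour_complex c b W) x =
      {F. x \<notin> F \<and> insert x F \<in> bounded_colour_complex c b W}"
    unfolding link_def by auto
  also have "\<dots> = bounded_colour_complex c (b(c x := b (c x) - 1)) (W - {x})"
    using key assms(2) unfolding bounded_colour_complex_def by blast
  finally show ?thesis .
qed

text \<open>A face of the link leaves room for one more vertex of the colour of \<open>x\<close>, and this colour has
  more than \<open>b (c x) - 1\<close> vertices besides \<open>x\<close>, so one of them can be added without using \<open>x\<close>.\<close>

lemma link_face_not_facet_of_deletion:
  assumes "finite W" "x \<in> W" "0 < b (c x)" "b (c x) < card {v\<in>W. c v = c x}"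
    and "\<sigma> \<in> link (bounded_colour_complex c b W) x"
  shows "\<not> facet (deletion (bounded_colour_complex c b W) x) \<sigma>"
proof
  assume fac: "facet (deletion (bounded_colour_complex c b W) x) \<sigma>"
  have \<sigma>: "\<sigma> \<subseteq> W - {x}"
    and bd: "\<And>i. card {v\<in>\<sigma>. c v = i} \<le> (b(c x := b (c x) - 1)) i"
    using assms(5) link_bounded_colour_complex[of W x b c, OF assms(1-3)]
    unfolding bounded_colour_complex_def by auto
  have fin: "finite {v\<in>\<sigma>. c v = i}" for i using \<sigma> assms(1) finite_subset by fastforce
  have room: "card {v\<in>\<sigma>. c v = c x} < b (c x)" using bd[of "c x"] assms(3) by simp
  have "{v\<in>W. c v = c x} - {x} = {v\<in>W - {x}. c v = c x}" by auto
  then have "card {v\<in>W - {x}. c v = c x} = card {v\<in>W. c v = c x} - 1"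
    using assms(1,2) card_Diff_singleton[of x "{v\<in>W. c v = c x}"] by simp
  then have "card {v\<in>\<sigma>. c v = c x} < card {v\<in>W - {x}. c v = c x}"
    using room assms(4) by linarith
  then have "\<not> {v\<in>W - {x}. c v = c x} \<subseteq> {v\<in>\<sigma>. c v = c x}"
    using card_mono[OF fin] not_le by blast
  then obtain y where y: "y \<in> W - {x}" "c y = c x" "y \<notin> \<sigma>" by blast
  have "card {v\<in>insert y \<sigma>. c v = i} \<le> b i" for i
  proof (cases "i = c x")
    case True
    then have "{v\<in>insert y \<sigma>. c v = i} = insert y {v\<in>\<sigma>. c v = i}" using y by auto
    then have "card {v\<in>insert y \<sigma>. c v = i} = Suc (card {v\<in>\<sigma>. c v = i})" using fin y(3) by simp
    then show ?thesis using room True by simp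
  next
    case False
    then have "{v\<in>insert y \<sigma>. c v = i} = {v\<in>\<sigma>. c v = i}" using y(2) by auto
    then show ?thesis using bd[of i] False by simp
  qed
  then have "insert y \<sigma> \<in> deletion (bounded_colour_complex c b W) x"
    unfolding deletion_bounded_colour_complex using \<sigma> y(1)
    by (simp add: bounded_colour_complex_def)
  then show False using fac y(3) unfolding facet_def by blast
qed

lemma vertex_decomposable_bounded_colour_complex:
  assumes "finite W"
  shows "vertex_decomposable (bounded_colour_complex c b W)"
  using assms
proof (induction "card W" arbitrary: W b rule: less_induct)
  case less
  show ?case
  proof (cases "\<exists>x\<in>W. 0 < b (c x) \<and> b (c x) < card {v\<in>W. c v = c x}")
    case True
    then obtain x where x: "x \<in> W" "0 < b (c x)" "b (c x) < card {v\<in>W. c v = c x}" by blast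
    have smaller: "card (W - {x}) < card W" "finite (W - {x})"
      using less.prems x(1) card_Diff1_less[of W x] by auto
    have "shedding_vertex (bounded_colour_complex c b W) x"
    proof (rule shedding_vertexI)
      show "abstract_simplicial_complex {v\<in>W. 0 < b (c v)} (bounded_colour_complex c b W)"
        using bounded_colour_complex_is_complex less.prems .
      show "x \<in> {v\<in>W. 0 < b (c v)}" using x by simp
      show "vertex_decomposable (deletion (bounded_colour_complex c b W) x)"
        unfolding deletion_bounded_colour_complex using less.hyps smaller .
      show "vertex_decomposable (link (bounded_colour_complex c b W) x)"
        unfolding link_bounded_colour_complex[of W x b c, OF less.prems x(1,2)]
        using less.hyps smaller .
      show "\<nexists>\<sigma>. facet (link (bounded_colour_complex c b W) x) \<sigma> \<and>
                facet (deletion (bounded_colour_complex c b W) x) \<sigma>"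
        using link_face_not_facet_of_deletion[of W x b c, OF less.prems x] facet_def by blast
    qed
    then show ?thesis by (rule vd_shed)
  next
    case no_excess: False
    let ?V = "{v\<in>W. 0 < b (c v)}"
    have full: "card {v\<in>?V. c v = i} \<le> b i" for i
    proof (cases "{v\<in>?V. c v = i} = {}")
      case False
      then obtain x where x: "x \<in> W" "0 < b (c x)" "c x = i" by auto
      from x have "{v\<in>?V. c v = i} = {v\<in>W. c v = c x}" by auto
      moreover have "card {v\<in>W. c v = c x} \<le> b (c x)" using x no_excess not_less by blast
      ultimately show ?thesis using x(3) by simp
    next
      case True
      then show ?thesis by (metis card.empty le0)
    qed
    have "abstract_simplicial_complex ?V (bounded_colour_complex c b W)"
      using bounded_colour_complex_is_complex less.prems .
    moreover have "?V \<in> bounded_colour_complex c b W"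
      using full unfolding bounded_colour_complex_def by blast
    ultimately have "F \<in> bounded_colour_complex c b W \<longleftrightarrow> F \<subseteq> ?V" for F
      unfolding abstract_simplicial_complex_def by (meson PowD subsetD)
    then have "bounded_colour_complex c b W = generated_complex {?V}"
      unfolding generated_complex_def by (intro set_eqI) simp
    then have "is_simplex (bounded_colour_complex c b W)"
      unfolding is_simplex_def using less.prems by (intro exI[of _ ?V]) simp
    then show ?thesis by (intro vd_simplex disjI1)
  qed
qed

text \<open>A face \<open>G\<close> that respects the bounds extends to a generator of the rib part by part; the parts are
  large enough because the rib has some generator.\<close>

lemma rib_of_simplex:
  fixes a :: "nat ^ 'n" and c :: "'a \<Rightarrow> 'n"
  assumes cpx: "abstract_simplicial_complex V \<Sigma>" and simp: "is_simplex \<Sigma>"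
    and gens: "rib_generators a \<Sigma> P \<noteq> {}"
    and colour: "\<And>i. P i = {v\<in>V. c v = i}"
  shows "generated_complex (rib_generators a \<Sigma> P) = bounded_colour_complex c (($) a) V"
proof -
  have finV: "finite V" using cpx unfolding abstract_simplicial_complex_def by blast
  have \<Sigma>: "\<Sigma> = Pow V"
    using simp abstract_simplicial_complex_vertices[OF cpx]
    unfolding is_simplex_def generated_complex_def by auto
  have finP: "finite (P i)" for i using finV colour by simp
  have large: "a $ i \<le> card (P i)" for i
  proof -
    obtain F where F: "\<forall>i. F i \<subseteq> P i \<and> card (F i) = a $ i"
      using gens unfolding rib_generators_def by blast
    then show ?thesis using card_mono[OF finP[of i], of "F i"] by simp
  qed
  show ?thesis
  proof (intro equalityI subsetI)
    fix G assume "G \<in> generated_complex (rib_generators a \<Sigma> P)"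
    then obtain F where F: "G \<subseteq> (\<Union>i. F i)" "\<And>i. F i \<subseteq> P i" "\<And>i. card (F i) = a $ i"
      unfolding generated_complex_def rib_generators_def by blast
    have "card {v\<in>G. c v = i} \<le> a $ i" for i
    proof -
      have "c v = j" if "v \<in> F j" for v j using that F(2) colour by blast
      then have "{v\<in>G. c v = i} \<subseteq> F i" using F(1) by blast
      then show ?thesis using F(2,3) finP by (metis card_mono finite_subset)
    qed
    moreover have "G \<subseteq> V" using F(1,2) colour by blast
    ultimately show "G \<in> bounded_colour_complex c (($) a) V"
      unfolding bounded_colour_complex_def by blast
  next
    fix G assume "G \<in> bounded_colour_complex c (($) a) V"
    then have G: "G \<subseteq> V" "\<And>i. card {v\<in>G. c v = i} \<le> a $ i"
      unfolding bounded_colour_complex_def by auto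
    have "\<exists>B. {v\<in>G. c v = i} \<subseteq> B \<and> B \<subseteq> P i \<and> card B = a $ i" for i
    proof -
      have "{v\<in>G. c v = i} \<subseteq> P i" using G(1) colour by auto
      then show ?thesis
        using exists_subset_between[OF G(2) large _ finP, of i] by (metis (no_types))
    qed
    then obtain F where F: "\<And>i. {v\<in>G. c v = i} \<subseteq> F i" "\<And>i. F i \<subseteq> P i" "\<And>i. card (F i) = a $ i"
      by metis
    have "G \<subseteq> (\<Union>i. F i)" using F(1) by blast
    moreover have "(\<Union>i. F i) \<in> \<Sigma>" unfolding \<Sigma> using F(2) colour by blast
    then have "(\<Union>i. F i) \<in> rib_generators a \<Sigma> P"
      unfolding rib_generators_def using F(2,3) by (intro CollectI exI[of _ F]) simp
    ultimately show "G \<in> generated_complex (rib_generators a \<Sigma> P)"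
      unfolding generated_complex_def by (intro CollectI bexI)
  qed
qed

lemma vertex_decomposable_rib_of_simplex:
  fixes a :: "nat ^ 'n"
  assumes "abstract_simplicial_complex V \<Sigma>" "is_simplex \<Sigma>" "is_rib a V \<Sigma> \<Delta>"
  shows "vertex_decomposable \<Delta>"
proof -
  obtain P :: "'n \<Rightarrow> 'a set" where P: "ordered_partition V P" "rib_generators a \<Sigma> P \<noteq> {}"
      "\<Delta> = generated_complex (rib_generators a \<Sigma> P)"
    using assms(3) unfolding is_rib_def by blast
  define c where "c v = (SOME i. v \<in> P i)" for v
  have in_part: "v \<in> P (c v)" if "v \<in> P i" for v i
    unfolding c_def using that by (rule someI)
  have "c v = i" if "v \<in> P i" for v i
    using in_part[OF that] that P(1) unfolding ordered_partition_def disjoint_family_on_def by blast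
  then have "P i = {v\<in>V. c v = i}" for i
    using in_part P(1) unfolding ordered_partition_def by blast
  from rib_of_simplex[OF assms(1,2) P(2) this] P(3)
  have "\<Delta> = bounded_colour_complex c (($) a) V" by simp
  moreover have "finite V" using assms(1) unfolding abstract_simplicial_complex_def by blast
  ultimately show ?thesis using vertex_decomposable_bounded_colour_complex by metis
qed

lemma macaulay_decomposable_imp_vertex_decomposable:
  "macaulay_decomposable a \<Delta> \<Longrightarrow> vertex_decomposable \<Delta>"
  and macaulay_shedding_vertex_imp_shedding_vertex:
  "macaulay_shedding_vertex a \<Delta> x \<Longrightarrow> shedding_vertex \<Delta> x"
proof (induction rule: macaulay_decomposable_macaulay_shedding_vertex.inducts)
  case md_rib
  then show ?case by (rule vertex_decomposable_rib_of_simplex)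
next
  case md_shed
  then show ?case by (blast intro: vd_shed)
next
  case macaulay_shedding_vertexI
  then show ?case by (blast intro: shedding_vertexI)
qed

theorem proposition4p5:
  fixes a :: "nat ^ 'n" and V :: "'a set" and \<Delta> :: "'a set set"
  assumes "abstract_simplicial_complex V \<Delta>"
    and "macaulay_decomposable a \<Delta>"
  shows "vertex_decomposable \<Delta> \<and>
         (\<forall>x. macaulay_shedding_vertex a \<Delta> x \<longrightarrow> shedding_vertex \<Delta> x)"
proof (intro conjI allI impI)
  show "vertex_decomposable \<Delta>"
    using assms(2) by (rule macaulay_decomposable_imp_vertex_decomposable)
  show "shedding_vertex \<Delta> x" if "macaulay_shedding_vertex a \<Delta> x" for x
    using that by (rule macaulay_shedding_vertex_imp_shedding_vertex)
qed

end
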